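(* Let $\{u^n\}_{n=0}^N$ be the discrete DLR solution produced by the scheme described in the context with the semi-implicit evaluation $\mathcal L(u^n,u^{n+1})=\mathcal L_{\mathrm{det}}(u^{n+1})+\mathcal L_{\mathrm{stoch}}(u^n)$, where for constants $C_{\mathrm{det}},C_{\mathrm{stoch}}>0$, $$\langle u,u\rangle_{\mathcal L_{\mathrm{det}},\hat\rho}\ge C_{\mathrm{det}}\langle u,u\rangle_{\mathcal L,\hat\rho}\quad\text{and}\quad|(\mathcal L_{\mathrm{stoch}}(u),v)_{V'V,\hat\rho}|\le C_{\mathrm{stoch}}\|u\|_{V,\hat\rho}\|v\|_{V,\hat\rho}\qquad\forall u,v\in V_h\otimes L^2_{\hat\rho}.$$ Then: 1. For every $\kappa>0$ and $\triangle t,h$ satisfying $\dfrac{\triangle t}{h^{2p}}\le\dfrac{\kappa\,C_{\mathcal L}}{C_I^2C_{\mathrm{stoch}}^2}$, $$\|u^N\|_{H,\hat\rho}^2+\triangle t\,C_{\mathcal L}(1-\kappa)\sum_{n=0}^{N-1}\|u^{n+1}\|_{V,\hat\rho}^2\le\|u^0\|_{H,\hat\rho}^2+\frac{\triangle t\,C_P^2}{C_{\mathcal L}}\sum_{n=0}^{N-1}\|f^{n,n+1}\|_{H,\hat\rho}^2.$$ 2. If $\mathcal L$ is symmetric and $0<\kappa<2$, then $$\|u^N\|_{\mathcal L,\hat\rho}^2\le\|u^0\|_{\mathcal L,\hat\rho}^2+\frac{\triangle t}{\kappa}\sum_{n=0}^{N-1}\|f^{n,n+1}\|_{H,\hat\rho}^2$$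 for all $\triangle t,h$ if $C_{\mathrm{det}}\ge\frac12$, and for $\triangle t,h$ satisfying $\dfrac{\triangle t}{h^{2p}}\le\dfrac{2-\kappa}{C_I^2C_{\mathcal B}(1-2C_{\mathrm{det}})}$ if $C_{\mathrm{det}}<\frac12$. 3. If $f=0$ and $\mathcal L$ is symmetric, then $\|u^{n+1}\|_{\mathcal L,\hat\rho}\le\|u^n\|_{\mathcal L,\hat\rho}$ for $n=0,\dots,N-1$, for all $\triangle t,h$ if $C_{\mathrm{det}}\ge\frac12$, and for $\triangle t,h$ satisfying the weakened condition $\dfrac{\triangle t}{h^{2p}}\le\dfrac{2}{C_I^2C_{\mathcal B}(1-2C_{\mathrm{det}})}$ if $C_{\mathrm{det}}<\frac12$.
   Context: Setting. $V,H$ are separable real Hilbert spaces forming a Gelfand triple $V\subset H\subset V'$, with $V$ dense in $H$ and $\|v\|_H\le C_P\|v\|_V$ for $v\in V$, $C_P>0$; $(\cdot,\cdot)_{V'V}$ is the duality pairing, extending $\langle\cdot,\cdot\rangle_H$. $\hat\Gamma=\{\omega_1,\dots,\omega_{\hat N}\}$ is a finite set of points with weights $\lambda_k>0$, $\sum_k\lambda_k=1$, $\hat\rho=\sum_k\lambda_k\delta_{\omega_k}$. $L^2_{\hat\rho}$ is the space of real functions on $\hat\Gamma$ with $\langle v,w\rangle_{L^2_{\hat\rho}}=\sum_k\lambda_kv(\omega_k)w(\omega_k)$; $\mathbb E_{\hat\rho}[v]=\sum_k\lambda_kv(\omega_k)$ (also for vector-valued $v$); $v^*:=v-\mathbb E_{\hat\rho}[v]$.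 For $X\in\{V,H\}$ and functions $\hat\Gamma\to X$: $\langle v,w\rangle_{X,\hat\rho}=\sum_k\lambda_k\langle v(\omega_k),w(\omega_k)\rangle_X$ with norm $\|\cdot\|_{X,\hat\rho}$; for $\mathcal K:\hat\Gamma\to V'$, $(\mathcal K,v)_{V'V,\hat\rho}=\sum_k\lambda_k(\mathcal K(\omega_k),v(\omega_k))_{V'V}$. $L(\omega):V\to V'$ is a linear operator for each $\omega$, with constants $C_{\mathcal L},C_{\mathcal B}>0$ such that $(L(\omega)v,v)_{V'V}\ge C_{\mathcal L}\|v\|_V^2$ and $(L(\omega)v,w)_{V'V}\le C_{\mathcal B}\|v\|_V\|w\|_V$ for all $\omega$ and $v,w\in V$; $\mathcal L(u)(\omega)=L(\omega)u(\omega)$ and $\langle v,w\rangle_{\mathcal L,\hat\rho}=(\mathcal L(v),w)_{V'V,\hat\rho}$. "$\mathcal L$ symmetric" means each form $(L(\omega)v,w)_{V'V}$ is symmetric in $v,w\in V$; then $\|v\|_{\mathcal L,\hat\rho}^2=\langle v,v\rangle_{\mathcal L,\hat\rho}$. Splitting: $\mathcal L(u)=\mathcal L_{\mathrm{det}}(u)+\mathcal L_{\mathrm{stoch}}(u)$, where $\mathcal L_{\mathrm{det}}:V\to V'$ is a linear deterministic operator whose bilinear form $\langle u,v\rangle_{\mathcal L_{\mathrm{det}}}=(\mathcal L_{\mathrm{det}}(u),v)_{V'V}$ on $V$ is bounded and coercive; it acts pointwise in $\omega$ on functions $\hat\Gamma\to V$, and $\langle u,v\rangle_{\mathcal L_{\mathrm{det}},\hat\rho}=\sum_k\lambda_k(\mathcal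 L_{\mathrm{det}}(u(\omega_k)),v(\omega_k))_{V'V}$. $V_h\subset V$ is a finite-dimensional subspace (parameter $h>0$), $\dim V_h>R$, $R<\hat N$; $V_h\otimes L^2_{\hat\rho}$ is identified with functions $\hat\Gamma\to V_h$, and the inverse inequality $\|v\|_{V,\hat\rho}\le\frac{C_I}{h^p}\|v\|_{H,\hat\rho}$ holds for all $v\in V_h\otimes L^2_{\hat\rho}$, for some $p\in\mathbb N$, $C_I>0$. $\triangle t=T/N$, $t_n=n\triangle t$. $f^{n,n+1}:\hat\Gamma\to H$ is $f(t_n)$, $f(t_{n+1})$, or any convex combination of both. Scheme (one step, from $u^n$ to $u^{n+1}$). Given $u^n=\bar u^n+\sum_{j=1}^RU^n_jY^n_j$ with $\bar u^n,U^n_j\in V_h$, $Y^n_j\in L^2_{\hat\rho}$, $\langle Y^n_i,Y^n_j\rangle_{L^2_{\hat\rho}}=\delta_{ij}$, $\mathbb E_{\hat\rho}[Y^n_j]=0$; write $U=(U_1,\dots,U_R)$, $Y=(Y_1,\dots,Y_R)$ and $G:=\mathcal L(u^n,u^{n+1})-f^{n,n+1}$. 1. $\bar u^{n+1}\in V_h$: $\langle\frac{\bar u^{n+1}-\bar u^n}{\triangle t},v_h\rangle_H+(\mathbb E_{\hat\rho}[G],v_h)_{V'V}=0$ for all $v_h\in V_h$. 2. $\tilde U^{n+1}_j\in V_h$: $\langle\frac{\tilde U^{n+1}_j-U^n_j}{\triangle t},v_h\rangle_H+(\mathbb E_{\hat\rho}[G\,Y^n_j],v_h)_{V'V}=0$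 for all $v_h\in V_h$, $j=1,\dots,R$. 3. $\tilde Y^{n+1}\in(L^2_{\hat\rho})^R$: $\frac{\tilde Y^{n+1}-Y^n}{\triangle t}\tilde M^{n+1}+\mathcal P^\perp_{\hat\rho,\mathcal Y^n}\big[(G^*,\tilde U^{n+1})_{V'V}\big]=0$, where $\tilde M^{n+1}_{ij}=\langle\tilde U^{n+1}_i,\tilde U^{n+1}_j\rangle_H$, $(G^*,\tilde U^{n+1})_{V'V}$ is the row $((G^*,\tilde U^{n+1}_j)_{V'V})_j$ of elements of $L^2_{\hat\rho}$, and $\mathcal P^\perp_{\hat\rho,\mathcal Y^n}$ is the $L^2_{\hat\rho}$-orthogonal projection onto the orthogonal complement of $\mathcal Y^n=\mathrm{span}\{Y^n_1,\dots,Y^n_R\}$. If $\tilde M^{n+1}$ is singular, $\tilde Y^{n+1}$ is a solution of this equation minimizing $\|\tilde Y^{n+1}-Y^n\|_{L^2_{\hat\rho}}$ (norm on $(L^2_{\hat\rho})^R$). 4. Reorthonormalize: $(U^{n+1},Y^{n+1})$ with $\sum_jY^{n+1}_jU^{n+1}_j=\sum_j\tilde Y^{n+1}_j\tilde U^{n+1}_j$, $\langle Y^{n+1}_i,Y^{n+1}_j\rangle_{L^2_{\hat\rho}}=\delta_{ij}$ (and zero-mean $Y^{n+1}_j$). 5. $u^{n+1}=\bar u^{n+1}+\sum_jU^{n+1}_jY^{n+1}_j$. Throughout, it is assumed that a discrete DLR solution exists. *)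

theory Defs
  imports "HOL-Analysis.Analysis"
begin

text \<open>
  The Gelfand triple is given by a bounded linear embedding \<open>\<iota>\<close> of \<open>V\<close> (the type \<open>'v\<close>) into
  \<open>H\<close> (the type \<open>'h\<close>); the dual \<open>V'\<close> is the type \<open>'v \<Rightarrow>\<^sub>L real\<close>, so that the duality pairing
  is application of a bounded linear functional.  The finite set of sample points is a type
  \<open>'w :: finite\<close> with weights \<open>lam\<close>; functions on the sample set with values in \<open>X\<close> are total
  functions \<open>'w \<Rightarrow> 'x\<close>.  The modes \<open>1, ..., R\<close> are indexed by a type \<open>'r :: finite\<close>,
  so \<open>R = CARD('r)\<close>.
\<close>

definition gelfand_triple ::
    "('v::real_inner \<Rightarrow>\<^sub>L 'h::real_inner) \<Rightarrow> real \<Rightarrow> bool" where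
  "gelfand_triple \<iota> CP \<longleftrightarrow>
     inj (blinfun_apply \<iota>) \<and> closure (range (blinfun_apply \<iota>)) = UNIV \<and>
     CP > 0 \<and> (\<forall>v. norm (\<iota> v) \<le> CP * norm v)"

text \<open>The inclusion of \<open>H\<close> into \<open>V'\<close>: \<open>x\<close> is sent to the functional \<open>v \<mapsto> \<langle>x, \<iota> v\<rangle>\<close>.\<close>

definition H_to_dual ::
    "('v::real_inner \<Rightarrow>\<^sub>L 'h::real_inner) \<Rightarrow> 'h \<Rightarrow> ('v \<Rightarrow>\<^sub>L real)" where
  "H_to_dual \<iota> x = blinfun_inner_right x o\<^sub>L \<iota>"

definition discrete_prob :: "('w::finite \<Rightarrow> real) \<Rightarrow> bool" where
  "discrete_prob lam \<longleftrightarrow> (\<forall>\<omega>. lam \<omega> > 0) \<and> (\<Sum>\<omega>\<in>UNIV. lam \<omega>) = 1"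

definition mean :: "('w::finite \<Rightarrow> real) \<Rightarrow> ('w \<Rightarrow> 'x::real_vector) \<Rightarrow> 'x" where
  "mean lam v = (\<Sum>\<omega>\<in>UNIV. lam \<omega> *\<^sub>R v \<omega>)"

definition centered ::
    "('w::finite \<Rightarrow> real) \<Rightarrow> ('w \<Rightarrow> 'x::real_vector) \<Rightarrow> 'w \<Rightarrow> 'x" where
  "centered lam v = (\<lambda>\<omega>. v \<omega> - mean lam v)"

text \<open>
  The inner product and norm of functions with values in \<open>V\<close> or \<open>H\<close>, depending on the type of the
  argument; for \<open>'x = real\<close> they are those of \<open>L\<^sup>2\<close>.
\<close>

definition ip ::
    "('w::finite \<Rightarrow> real) \<Rightarrow> ('w \<Rightarrow> 'x::real_inner) \<Rightarrow> ('w \<Rightarrow> 'x) \<Rightarrow> real" where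
  "ip lam v w = (\<Sum>\<omega>\<in>UNIV. lam \<omega> * inner (v \<omega>) (w \<omega>))"

definition nrm :: "('w::finite \<Rightarrow> real) \<Rightarrow> ('w \<Rightarrow> 'x::real_inner) \<Rightarrow> real" where
  "nrm lam v = sqrt (ip lam v v)"

definition nrmH ::
    "('v::real_inner \<Rightarrow>\<^sub>L 'h::real_inner) \<Rightarrow> ('w::finite \<Rightarrow> real) \<Rightarrow> ('w \<Rightarrow> 'v) \<Rightarrow> real" where
  "nrmH \<iota> lam v = nrm lam (\<lambda>\<omega>. \<iota> (v \<omega>))"

definition dual_pair ::
    "('w::finite \<Rightarrow> real) \<Rightarrow> ('w \<Rightarrow> 'v::real_normed_vector \<Rightarrow>\<^sub>L real) \<Rightarrow> ('w \<Rightarrow> 'v) \<Rightarrow> real" where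
  "dual_pair lam K v = (\<Sum>\<omega>\<in>UNIV. lam \<omega> * K \<omega> (v \<omega>))"

definition apply_op :: "('w \<Rightarrow> 'v \<Rightarrow> 'y) \<Rightarrow> ('w \<Rightarrow> 'v) \<Rightarrow> 'w \<Rightarrow> 'y" where
  "apply_op L u = (\<lambda>\<omega>. L \<omega> (u \<omega>))"

definition op_ip ::
    "('w::finite \<Rightarrow> real) \<Rightarrow> ('w \<Rightarrow> 'v::real_normed_vector \<Rightarrow> ('v \<Rightarrow>\<^sub>L real))
      \<Rightarrow> ('w \<Rightarrow> 'v) \<Rightarrow> ('w \<Rightarrow> 'v) \<Rightarrow> real" where
  "op_ip lam L u v = dual_pair lam (apply_op L u) v"

definition op_nrm ::
    "('w::finite \<Rightarrow> real) \<Rightarrow> ('w \<Rightarrow> 'v::real_normed_vector \<Rightarrow> ('v \<Rightarrow>\<^sub>L real))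
      \<Rightarrow> ('w \<Rightarrow> 'v) \<Rightarrow> real" where
  "op_nrm lam L v = sqrt (op_ip lam L v v)"

definition symmetric_op ::
    "('w \<Rightarrow> 'v::real_normed_vector \<Rightarrow> ('v \<Rightarrow>\<^sub>L real)) \<Rightarrow> bool" where
  "symmetric_op L \<longleftrightarrow> (\<forall>\<omega> v w. L \<omega> v w = L \<omega> w v)"

text \<open>\<open>V\<^sub>h \<otimes> L\<^sup>2\<close>, as the functions on the sample set with values in \<open>V\<^sub>h\<close>.\<close>

definition tensor_space :: "'v set \<Rightarrow> ('w \<Rightarrow> 'v) set" where
  "tensor_space Vh = {v. \<forall>\<omega>. v \<omega> \<in> Vh}"

definition L2_span :: "('r::finite \<Rightarrow> 'w \<Rightarrow> real) \<Rightarrow> ('w \<Rightarrow> real) set" where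
  "L2_span Y = {v. \<exists>c. v = (\<lambda>\<omega>. \<Sum>j\<in>UNIV. c j * Y j \<omega>)}"

definition L2_complement ::
    "('w::finite \<Rightarrow> real) \<Rightarrow> ('w \<Rightarrow> real) set \<Rightarrow> ('w \<Rightarrow> real) set" where
  "L2_complement lam S = {v. \<forall>y\<in>S. ip lam v y = 0}"

text \<open>
  Orthogonal projection onto a linear subspace \<open>W\<close>; for positive weights it exists and is unique,
  the space of all functions being finite-dimensional.
\<close>

definition L2_proj ::
    "('w::finite \<Rightarrow> real) \<Rightarrow> ('w \<Rightarrow> real) set \<Rightarrow> ('w \<Rightarrow> real) \<Rightarrow> 'w \<Rightarrow> real" where
  "L2_proj lam W v = (THE w. w \<in> W \<and> (\<forall>z\<in>W. ip lam (\<lambda>\<omega>. v \<omega> - w \<omega>) z = 0))"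

definition dlr_field ::
    "'v::real_vector \<Rightarrow> ('r::finite \<Rightarrow> 'v) \<Rightarrow> ('r \<Rightarrow> 'w \<Rightarrow> real) \<Rightarrow> 'w \<Rightarrow> 'v" where
  "dlr_field ub U Y = (\<lambda>\<omega>. ub + (\<Sum>j\<in>UNIV. Y j \<omega> *\<^sub>R U j))"

definition dlr_state ::
    "('w::finite \<Rightarrow> real) \<Rightarrow> 'v set \<Rightarrow> 'v \<Rightarrow> ('r::finite \<Rightarrow> 'v) \<Rightarrow> ('r \<Rightarrow> 'w \<Rightarrow> real) \<Rightarrow> bool" where
  "dlr_state lam Vh ub U Y \<longleftrightarrow>
     ub \<in> Vh \<and> (\<forall>j. U j \<in> Vh) \<and>
     (\<forall>i j. ip lam (Y i) (Y j) = (if i = j then 1 else 0)) \<and>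
     (\<forall>j. mean lam (Y j) = 0)"

definition gram ::
    "('v::real_inner \<Rightarrow>\<^sub>L 'h::real_inner) \<Rightarrow> ('r::finite \<Rightarrow> 'v) \<Rightarrow> real^'r^'r" where
  "gram \<iota> U = (\<chi> i j. inner (\<iota> (U i)) (\<iota> (U j)))"

text \<open>
  \<open>Yt\<close> solves the equation for the stochastic modes, an equation between row vectors
  of functions (\<open>v*\<close> is the product of a row vector with a matrix).
\<close>

definition stoch_mode_eq ::
    "('v::real_inner \<Rightarrow>\<^sub>L 'h::real_inner) \<Rightarrow> ('w::finite \<Rightarrow> real) \<Rightarrow> real \<Rightarrow>
      ('w \<Rightarrow> 'v \<Rightarrow>\<^sub>L real) \<Rightarrow> ('r::finite \<Rightarrow> 'w \<Rightarrow> real) \<Rightarrow> ('r \<Rightarrow> 'v) \<Rightarrow> ('r \<Rightarrow> 'w \<Rightarrow> real) \<Rightarrow> bool" where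
  "stoch_mode_eq \<iota> lam dt G Y Ut Yt \<longleftrightarrow>
     (\<forall>\<omega> j. ((\<chi> i. (Yt i \<omega> - Y i \<omega>) / dt) v* gram \<iota> Ut) $ j
        + L2_proj lam (L2_complement lam (L2_span Y)) (\<lambda>\<omega>'. centered lam G \<omega>' (Ut j)) \<omega> = 0)"

definition modes_dist ::
    "('w::finite \<Rightarrow> real) \<Rightarrow> ('r::finite \<Rightarrow> 'w \<Rightarrow> real) \<Rightarrow> ('r \<Rightarrow> 'w \<Rightarrow> real) \<Rightarrow> real" where
  "modes_dist lam Z Y = sqrt (\<Sum>j\<in>UNIV. (nrm lam (\<lambda>\<omega>. Z j \<omega> - Y j \<omega>))\<^sup>2)"

text \<open>
  One step of the splitting scheme, from \<open>(ub, U, Y)\<close> to \<open>(ub', U', Y')\<close>.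
  Here \<open>G\<close> is the evaluated \<open>\<L>(u\<^sup>n, u\<^sup>n\<^sup>+\<^sup>1) - f\<^sup>n\<^sup>,\<^sup>n\<^sup>+\<^sup>1\<close>, which may itself
  depend on the new state.
\<close>

definition dlr_step ::
    "('v::real_inner \<Rightarrow>\<^sub>L 'h::real_inner) \<Rightarrow> ('w::finite \<Rightarrow> real) \<Rightarrow> 'v set \<Rightarrow> real \<Rightarrow>
      ('w \<Rightarrow> 'v \<Rightarrow>\<^sub>L real) \<Rightarrow>
      'v \<Rightarrow> ('r::finite \<Rightarrow> 'v) \<Rightarrow> ('r \<Rightarrow> 'w \<Rightarrow> real) \<Rightarrow>
      'v \<Rightarrow> ('r \<Rightarrow> 'v) \<Rightarrow> ('r \<Rightarrow> 'w \<Rightarrow> real) \<Rightarrow> bool" where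
  "dlr_step \<iota> lam Vh dt G ub U Y ub' U' Y' \<longleftrightarrow>
     (\<forall>v\<in>Vh. inner (\<iota> ((1 / dt) *\<^sub>R (ub' - ub))) (\<iota> v) + mean lam G v = 0) \<and>
     (\<exists>Ut Yt.
        (\<forall>j. Ut j \<in> Vh) \<and>
        (\<forall>j. \<forall>v\<in>Vh. inner (\<iota> ((1 / dt) *\<^sub>R (Ut j - U j))) (\<iota> v)
                       + mean lam (\<lambda>\<omega>. Y j \<omega> *\<^sub>R G \<omega>) v = 0) \<and>
        stoch_mode_eq \<iota> lam dt G Y Ut Yt \<and>
        (\<not> invertible (gram \<iota> Ut) \<longrightarrow>
           (\<forall>Z. stoch_mode_eq \<iota> lam dt G Y Ut Z \<longrightarrow> modes_dist lam Yt Y \<le> modes_dist lam Z Y)) \<and>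
        (\<forall>\<omega>. (\<Sum>j\<in>UNIV. Y' j \<omega> *\<^sub>R U' j) = (\<Sum>j\<in>UNIV. Yt j \<omega> *\<^sub>R Ut j))) \<and>
     dlr_state lam Vh ub' U' Y'"

text \<open>
  A discrete solution with \<open>N\<close> steps of size \<open>dt\<close>; \<open>LL u\<^sup>n u\<^sup>n\<^sup>+\<^sup>1\<close> is the chosen evaluation of the
  operator and \<open>F n\<close> stands for \<open>f\<^sup>n\<^sup>,\<^sup>n\<^sup>+\<^sup>1\<close>.
\<close>

definition dlr_solution ::
    "('v::real_inner \<Rightarrow>\<^sub>L 'h::real_inner) \<Rightarrow> ('w::finite \<Rightarrow> real) \<Rightarrow> 'v set \<Rightarrow>
      (('w \<Rightarrow> 'v) \<Rightarrow> ('w \<Rightarrow> 'v) \<Rightarrow> 'w \<Rightarrow> 'v \<Rightarrow>\<^sub>L real) \<Rightarrow> (nat \<Rightarrow> 'w \<Rightarrow> 'h) \<Rightarrow> real \<Rightarrow> nat \<Rightarrow>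
      (nat \<Rightarrow> 'v) \<Rightarrow> (nat \<Rightarrow> 'r::finite \<Rightarrow> 'v) \<Rightarrow> (nat \<Rightarrow> 'r \<Rightarrow> 'w \<Rightarrow> real) \<Rightarrow>
      (nat \<Rightarrow> 'w \<Rightarrow> 'v) \<Rightarrow> bool" where
  "dlr_solution \<iota> lam Vh LL F dt N ub U Y u \<longleftrightarrow>
     dlr_state lam Vh (ub 0) (U 0) (Y 0) \<and>
     (\<forall>n\<le>N. u n = dlr_field (ub n) (U n) (Y n)) \<and>
     (\<forall>n<N. dlr_step \<iota> lam Vh dt
               (\<lambda>\<omega>. LL (u n) (u (Suc n)) \<omega> - H_to_dual \<iota> (F n \<omega>))
               (ub n) (U n) (Y n) (ub (Suc n)) (U (Suc n)) (Y (Suc n)))"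

definition semi_implicit ::
    "('v \<Rightarrow> 'y::plus) \<Rightarrow> ('w \<Rightarrow> 'v \<Rightarrow> 'y) \<Rightarrow> ('w \<Rightarrow> 'v) \<Rightarrow> ('w \<Rightarrow> 'v) \<Rightarrow> 'w \<Rightarrow> 'y" where
  "semi_implicit Ldet Lstoch u u' = (\<lambda>\<omega>. Ldet (u' \<omega>) + Lstoch \<omega> (u \<omega>))"

text \<open>
  \<open>F n\<close> is \<open>f(t\<^sub>n)\<close>, \<open>f(t\<^sub>n\<^sub>+\<^sub>1)\<close> or any convex combination of them, where \<open>t\<^sub>n = n * dt\<close>.
\<close>

definition rhs_eval ::
    "(real \<Rightarrow> 'w \<Rightarrow> 'h::real_vector) \<Rightarrow> real \<Rightarrow> nat \<Rightarrow> (nat \<Rightarrow> 'w \<Rightarrow> 'h) \<Rightarrow> bool" where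
  "rhs_eval f dt N F \<longleftrightarrow>
     (\<forall>n<N. \<exists>\<theta>\<in>{0..1}. \<forall>\<omega>.
        F n \<omega> = (1 - \<theta>) *\<^sub>R f (real n * dt) \<omega> + \<theta> *\<^sub>R f (real (Suc n) * dt) \<omega>)"

end

theory Submission
  imports Defs
begin

text \<open>
  The scheme is a Galerkin method in disguise: each step makes the residual vanish on test
  functions that include the new field and the increment.  Testing with the new field gives the
  \<open>H\<close>-estimate.  Testing with the increment \<open>d\<close> and using the symmetry of \<open>\<L>\<close> to write
  \<open>2\<langle>u\<^sup>n, d\<rangle>\<^sub>\<L>\<close> as \<open>|u\<^sup>n\<^sup>+\<^sup>1|\<^sup>2 - |u\<^sup>n|\<^sup>2 - |d|\<^sup>2\<close> gives the two energy estimates.  In both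
  cases the explicitly treated terms are absorbed into the numerical dissipation \<open>|d|\<^sup>2\<close> of the
  \<open>H\<close>-norm by the inverse inequality and the step size restriction.
\<close>

section \<open>Averages, inner products and norms over the sample points\<close>

lemma mean_add: "mean lam (\<lambda>\<omega>. v \<omega> + w \<omega>) = mean lam v + mean lam w"
  by (simp add: mean_def scaleR_add_right sum.distrib)

lemma mean_diff: "mean lam (\<lambda>\<omega>. v \<omega> - w \<omega>) = mean lam v - mean lam w"
  by (simp add: mean_def scaleR_diff_right sum_subtractf)

lemma mean_sum: "mean lam (\<lambda>\<omega>. \<Sum>j\<in>J. v j \<omega>) = (\<Sum>j\<in>J. mean lam (v j))"
  unfolding mean_def scaleR_sum_right by (rule sum.swap)

lemma mean_const: "discrete_prob lam \<Longrightarrow> mean lam (\<lambda>\<omega>. c) = c"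
  by (simp add: mean_def discrete_prob_def flip: scaleR_sum_left)

lemma mean_scaleR_left: "mean lam (\<lambda>\<omega>. y \<omega> *\<^sub>R c) = mean lam y *\<^sub>R c"
  by (simp add: mean_def scaleR_sum_left)

lemma mean_linear_image:
  assumes "linear T"
  shows "mean lam (\<lambda>\<omega>. T (v \<omega>)) = T (mean lam v)"
  by (simp add: mean_def linear_sum[OF assms] linear_scale[OF assms])

lemma mean_blinfun_apply:
  fixes K :: "'w::finite \<Rightarrow> 'v::real_normed_vector \<Rightarrow>\<^sub>L real"
  shows "mean lam K v = mean lam (\<lambda>\<omega>. K \<omega> v)"
  by (simp add: mean_def blinfun.sum_left blinfun.scaleR_left)

lemma ip_eq_mean: "ip lam v w = mean lam (\<lambda>\<omega>. inner (v \<omega>) (w \<omega>))"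
  by (simp add: ip_def mean_def)

lemma dual_pair_eq_mean: "dual_pair lam K v = mean lam (\<lambda>\<omega>. K \<omega> (v \<omega>))"
  by (simp add: dual_pair_def mean_def)

lemma mean_inner_left: "mean lam (\<lambda>\<omega>. inner c (v \<omega>)) = inner c (mean lam v)"
  by (rule mean_linear_image) (simp add: bounded_linear.linear bounded_linear_inner_right)

lemma mean_inner_right: "mean lam (\<lambda>\<omega>. inner (v \<omega>) c) = inner (mean lam v) c"
  by (rule mean_linear_image) (simp add: bounded_linear.linear bounded_linear_inner_left)

lemma ip_commute: "ip lam v w = ip lam w v"
  by (simp add: ip_def inner_commute)

lemma ip_nonneg: "discrete_prob lam \<Longrightarrow> 0 \<le> ip lam v v"
  by (simp add: ip_def discrete_prob_def less_imp_le sum_nonneg)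

lemma nrm_nonneg: "discrete_prob lam \<Longrightarrow> 0 \<le> nrm lam v"
  by (simp add: nrm_def ip_nonneg)

lemma nrm_sq: "discrete_prob lam \<Longrightarrow> (nrm lam v)\<^sup>2 = ip lam v v"
  by (simp add: nrm_def ip_nonneg)

lemma ip_eq_0_iff:
  assumes "discrete_prob lam"
  shows "ip lam v v = 0 \<longleftrightarrow> v = (\<lambda>\<omega>. 0)"
proof -
  have pos: "\<And>\<omega>. 0 < lam \<omega>"
    using assms by (simp add: discrete_prob_def)
  then have "ip lam v v = 0 \<longleftrightarrow> (\<forall>\<omega>. lam \<omega> * inner (v \<omega>) (v \<omega>) = 0)"
    unfolding ip_def by (subst sum_nonneg_eq_0_iff) (auto simp: less_imp_le)
  also have "\<dots> \<longleftrightarrow> v = (\<lambda>\<omega>. 0)"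
    using pos by (auto simp: fun_eq_iff less_imp_neq[symmetric])
  finally show ?thesis .
qed

lemma mean_mono:
  fixes v :: "'w::finite \<Rightarrow> real"
  assumes "discrete_prob lam" "\<And>\<omega>. v \<omega> \<le> w \<omega>"
  shows "mean lam v \<le> mean lam w"
  unfolding mean_def real_scaleR_def
proof (rule sum_mono)
  fix \<omega>
  show "lam \<omega> * v \<omega> \<le> lam \<omega> * w \<omega>"
    using assms by (simp add: discrete_prob_def mult_left_mono less_imp_le)
qed

lemma mean_mult_left:
  fixes v :: "'w::finite \<Rightarrow> real"
  shows "mean lam (\<lambda>\<omega>. c * v \<omega>) = c * mean lam v"
  by (simp add: mean_def sum_distrib_left mult_ac)

lemma young:
  fixes a b c :: real
  assumes "c > 0"
  shows "a * b \<le> c / 2 * a\<^sup>2 + 1 / (2 * c) * b\<^sup>2"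
proof -
  have "0 \<le> (c * a - b)\<^sup>2 / (2 * c)"
    using assms by simp
  also have "\<dots> = c / 2 * a\<^sup>2 + 1 / (2 * c) * b\<^sup>2 - a * b"
    using assms by (simp add: field_simps power2_eq_square)
  finally show ?thesis by simp
qed

text \<open>The weight \<open>c\<close> stays free because the two energy estimates balance the
  source term differently: one against the new field, the other against the increment.\<close>

lemma ip_young:
  assumes "discrete_prob lam" "c > 0"
  shows "ip lam v w \<le> c / 2 * (nrm lam v)\<^sup>2 + 1 / (2 * c) * (nrm lam w)\<^sup>2"
proof -
  have "ip lam v w \<le> mean lam (\<lambda>\<omega>. c / 2 * inner (v \<omega>) (v \<omega>) + 1 / (2 * c) * inner (w \<omega>) (w \<omega>))"
    unfolding ip_eq_mean
  proof (rule mean_mono[OF assms(1)])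
    fix \<omega>
    have "inner (v \<omega>) (w \<omega>) \<le> norm (v \<omega>) * norm (w \<omega>)"
      by (rule norm_cauchy_schwarz)
    also have "\<dots> \<le> c / 2 * (norm (v \<omega>))\<^sup>2 + 1 / (2 * c) * (norm (w \<omega>))\<^sup>2"
      by (rule young[OF assms(2)])
    finally show "inner (v \<omega>) (w \<omega>)
        \<le> c / 2 * inner (v \<omega>) (v \<omega>) + 1 / (2 * c) * inner (w \<omega>) (w \<omega>)"
      by (simp add: power2_norm_eq_inner)
  qed
  then show ?thesis
    by (simp only: mean_add mean_mult_left nrm_sq[OF assms(1)] ip_eq_mean)
qed

text \<open>Origin of the numerical dissipation: besides the difference of the squared norms,
  testing an increment with the new value leaves the square of the increment, which later absorbs
  the explicitly treated part.\<close>

lemma ip_polarization: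
  "2 * ip lam (\<lambda>\<omega>. v \<omega> - w \<omega>) v = ip lam v v - ip lam w w + ip lam (\<lambda>\<omega>. v \<omega> - w \<omega>) (\<lambda>\<omega>. v \<omega> - w \<omega>)"
  by (simp add: ip_def inner_diff_left inner_diff_right inner_commute algebra_simps
      sum.distrib sum_subtractf sum_distrib_left)

section \<open>The projected equation for the stochastic modes\<close>

text \<open>By orthonormality the Fourier expansion in the \<open>Y i\<close> projects onto their
  span, and subtracting it projects onto the complement. This turns the definite description into a
  formula; uniqueness rests on the weights being positive, which makes \<open>ip\<close>
  definite.\<close>

lemma L2_proj_complement_span:
  fixes Y :: "'r::finite \<Rightarrow> 'w::finite \<Rightarrow> real"
  assumes prob: "discrete_prob lam"
    and orth: "\<And>i j. ip lam (Y i) (Y j) = (if i = j then 1 else 0)"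
  shows "L2_proj lam (L2_complement lam (L2_span Y)) g
    = (\<lambda>\<omega>. g \<omega> - (\<Sum>i\<in>UNIV. ip lam g (Y i) * Y i \<omega>))" (is "_ = ?w")
proof -
  define C where "C = L2_complement lam (L2_span Y)"
  have ip_span: "ip lam v (\<lambda>\<omega>. \<Sum>j\<in>UNIV. c j * Y j \<omega>) = (\<Sum>j\<in>UNIV. c j * ip lam v (Y j))" for v c
    unfolding ip_def sum_distrib_left inner_sum_right
    by (subst sum.swap) (simp add: algebra_simps)
  have diff: "ip lam (\<lambda>\<omega>. v \<omega> - v' \<omega>) z = ip lam v z - ip lam v' z" for v v' z :: "'w \<Rightarrow> real"
    by (simp add: ip_eq_mean left_diff_distrib mean_diff)
  have C_iff: "v \<in> C \<longleftrightarrow> (\<forall>i. ip lam v (Y i) = 0)" for v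
  proof
    assume v: "v \<in> C"
    have "Y i \<in> L2_span Y" for i
      unfolding L2_span_def
      by (intro CollectI exI[of _ "\<lambda>j. if j = i then 1 else 0"])
        (simp add: if_distrib[of "\<lambda>c. c * _"] cong: if_cong)
    with v show "\<forall>i. ip lam v (Y i) = 0"
      by (simp add: C_def L2_complement_def)
  next
    assume "\<forall>i. ip lam v (Y i) = 0"
    then show "v \<in> C"
      by (auto simp: C_def L2_complement_def L2_span_def ip_span)
  qed
  define w\<^sub>0 where "w\<^sub>0 = ?w"
  have "ip lam (\<lambda>\<omega>. \<Sum>i\<in>UNIV. ip lam g (Y i) * Y i \<omega>) (Y j) = ip lam g (Y j)" for j
    by (subst ip_commute, subst ip_span)
      (simp add: orth if_distrib[of "\<lambda>c. _ * c"] cong: if_cong)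
  then have mem: "w\<^sub>0 \<in> C"
    unfolding C_iff w\<^sub>0_def diff by simp
  \<comment> \<open>The residual \<open>g - w\<^sub>0\<close> is an expansion in the
    \<open>Y i\<close>, hence orthogonal to all of \<open>C\<close>.\<close>
  have res: "ip lam (\<lambda>\<omega>. g \<omega> - w\<^sub>0 \<omega>) z = 0" if "z \<in> C" for z
  proof -
    have "ip lam (\<lambda>\<omega>. g \<omega> - w\<^sub>0 \<omega>) z = ip lam z (\<lambda>\<omega>. \<Sum>i\<in>UNIV. ip lam g (Y i) * Y i \<omega>)"
      by (simp add: w\<^sub>0_def ip_commute)
    also have "\<dots> = 0"
      using that unfolding ip_span C_iff by simp
    finally show ?thesis .
  qed
  \<comment> \<open>The difference of two candidates lies in \<open>C\<close> and is also a
    difference of two residuals orthogonal to \<open>C\<close>, so it is orthogonal to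
    itself.\<close>
  have uniq: "w = w\<^sub>0" if w: "w \<in> C" and ort: "\<forall>z\<in>C. ip lam (\<lambda>\<omega>. g \<omega> - w \<omega>) z = 0" for w
  proof -
    define d where "d = (\<lambda>\<omega>. w \<omega> - w\<^sub>0 \<omega>)"
    have d: "d \<in> C"
      using w mem unfolding C_iff d_def diff by simp
    have "d = (\<lambda>\<omega>. (g \<omega> - w\<^sub>0 \<omega>) - (g \<omega> - w \<omega>))"
      by (simp add: d_def)
    then have "ip lam d d = ip lam (\<lambda>\<omega>. g \<omega> - w\<^sub>0 \<omega>) d - ip lam (\<lambda>\<omega>. g \<omega> - w \<omega>) d"
      using diff[of "\<lambda>\<omega>. g \<omega> - w\<^sub>0 \<omega>" "\<lambda>\<omega>. g \<omega> - w \<omega>" d] by simp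
    also have "\<dots> = 0"
      by (simp only: res[OF d] bspec[OF ort d] diff_self)
    finally show ?thesis
      by (simp add: ip_eq_0_iff[OF prob] d_def fun_eq_iff)
  qed
  show ?thesis
    unfolding L2_proj_def C_def[symmetric] w\<^sub>0_def[symmetric]
    by (rule the_equality) (use mem res uniq in blast)+
qed

text \<open>Multiplying by the Gram matrix amounts to taking \<open>H\<close>-products with the
  \<open>Ut j\<close>. The mode equation is thus a Galerkin equation with test vectors
  \<open>Ut j\<close>, and no inverse of the Gram matrix enters.\<close>

lemma stoch_mode_eq_inner:
  fixes Y :: "'r::finite \<Rightarrow> 'w::finite \<Rightarrow> real"
  assumes prob: "discrete_prob lam" and "dt \<noteq> 0"
    and orth: "\<And>i j. ip lam (Y i) (Y j) = (if i = j then 1 else 0)"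
    and Y_mean: "\<And>j. mean lam (Y j) = 0"
    and eq: "stoch_mode_eq \<iota> lam dt G Y Ut Yt"
  shows "inner (\<iota> (\<Sum>i\<in>UNIV. (Yt i \<omega> - Y i \<omega>) *\<^sub>R Ut i)) (\<iota> (Ut j))
    = - dt * (G \<omega> - mean lam G - (\<Sum>i\<in>UNIV. Y i \<omega> *\<^sub>R mean lam (\<lambda>\<omega>'. Y i \<omega>' *\<^sub>R G \<omega>'))) (Ut j)"
    (is "_ = - dt * ?P")
proof -
  \<comment> \<open>Centring \<open>G\<close> does not change its coefficients against
    \<open>Y i\<close>, since the \<open>Y i\<close> have mean zero.\<close>
  have "ip lam (\<lambda>\<omega>'. centered lam G \<omega>' (Ut j)) (Y i)
      = mean lam (\<lambda>\<omega>'. Y i \<omega>' *\<^sub>R G \<omega>') (Ut j) - mean lam (\<lambda>\<omega>'. Y i \<omega>' *\<^sub>R mean lam G) (Ut j)" for i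
    by (simp add: ip_eq_mean centered_def mean_blinfun_apply blinfun.diff_left blinfun.scaleR_left
        algebra_simps flip: mean_diff)
  then have coeff: "ip lam (\<lambda>\<omega>'. centered lam G \<omega>' (Ut j)) (Y i)
      = mean lam (\<lambda>\<omega>'. Y i \<omega>' *\<^sub>R G \<omega>') (Ut j)" for i
    by (simp add: mean_scaleR_left Y_mean)
  have "inner (\<iota> (\<Sum>i\<in>UNIV. (Yt i \<omega> - Y i \<omega>) *\<^sub>R Ut i)) (\<iota> (Ut j))
      = dt * ((\<chi> i. (Yt i \<omega> - Y i \<omega>) / dt) v* gram \<iota> Ut) $ j"
    using \<open>dt \<noteq> 0\<close> by (simp add: vector_matrix_mult_def gram_def blinfun.sum_right
        blinfun.scaleR_right inner_sum_left sum_distrib_left mult.commute)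
  also have "((\<chi> i. (Yt i \<omega> - Y i \<omega>) / dt) v* gram \<iota> Ut) $ j
      = - L2_proj lam (L2_complement lam (L2_span Y)) (\<lambda>\<omega>'. centered lam G \<omega>' (Ut j)) \<omega>"
    using eq unfolding stoch_mode_eq_def by (simp add: eq_neg_iff_add_eq_0)
  also have "L2_proj lam (L2_complement lam (L2_span Y)) (\<lambda>\<omega>'. centered lam G \<omega>' (Ut j)) \<omega> = ?P"
    by (simp only: L2_proj_complement_span[OF prob orth] coeff)
      (simp add: centered_def blinfun.diff_left blinfun.sum_left blinfun.scaleR_left mult.commute)
  finally show ?thesis by simp
qed

section \<open>Orthogonal splitting of the fields and the Galerkin identity of one step\<close>

text \<open>Pythagoras: the constants, the modes \<open>Y j\<close> and \<open>W\<close> are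
  mutually orthogonal. Both arguments carry the same \<open>W\<close> because the new field and the
  increment differ only in the other two blocks.\<close>

lemma ip_orthogonal_decomposition:
  fixes Y :: "'r::finite \<Rightarrow> 'w::finite \<Rightarrow> real" and a a' :: "'x::real_inner"
  assumes prob: "discrete_prob lam"
    and orth: "\<And>i j. ip lam (Y i) (Y j) = (if i = j then 1 else 0)"
    and Y_mean: "\<And>j. mean lam (Y j) = 0"
    and W_mean: "mean lam W = 0" and YW_mean: "\<And>i. mean lam (\<lambda>\<omega>. Y i \<omega> *\<^sub>R W \<omega>) = 0"
  shows "ip lam (\<lambda>\<omega>. a + (\<Sum>j\<in>UNIV. Y j \<omega> *\<^sub>R b j) + W \<omega>) (\<lambda>\<omega>. a' + (\<Sum>j\<in>UNIV. Y j \<omega> *\<^sub>R b' j) + W \<omega>)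
    = inner a a' + (\<Sum>j\<in>UNIV. inner (b j) (b' j)) + ip lam W W"
proof -
  let ?v = "\<lambda>\<omega>. a' + (\<Sum>j\<in>UNIV. Y j \<omega> *\<^sub>R b' j) + W \<omega>"
  have mean_v: "mean lam ?v = a'"
    by (simp add: mean_add mean_const[OF prob] mean_sum mean_scaleR_left Y_mean W_mean)
  have "mean lam (\<lambda>\<omega>. Y i \<omega> *\<^sub>R ?v \<omega>)
      = mean lam (\<lambda>\<omega>. Y i \<omega> *\<^sub>R a' + (\<Sum>j\<in>UNIV. (Y i \<omega> * Y j \<omega>) *\<^sub>R b' j) + Y i \<omega> *\<^sub>R W \<omega>)" for i
    by (simp add: scaleR_add_right scaleR_sum_right)
  also have "\<dots> i = (\<Sum>j\<in>UNIV. ip lam (Y i) (Y j) *\<^sub>R b' j)" for i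
    by (simp add: mean_add mean_sum mean_scaleR_left Y_mean YW_mean ip_eq_mean)
  also have "\<dots> i = b' i" for i
    by (simp add: orth if_distrib[of "\<lambda>c. c *\<^sub>R _"] cong: if_cong)
  finally have mean_Yv: "mean lam (\<lambda>\<omega>. Y i \<omega> *\<^sub>R ?v \<omega>) = b' i" for i .
  have "mean lam (\<lambda>\<omega>. inner (W \<omega>) (?v \<omega>))
      = mean lam (\<lambda>\<omega>. inner (W \<omega>) a' + (\<Sum>j\<in>UNIV. inner (Y j \<omega> *\<^sub>R W \<omega>) (b' j)) + inner (W \<omega>) (W \<omega>))"
    by (simp add: inner_add_right inner_sum_right)
  also have "\<dots> = ip lam W W"
    by (simp only: mean_add mean_sum mean_inner_right W_mean YW_mean ip_eq_mean) simp
  finally have W_v: "mean lam (\<lambda>\<omega>. inner (W \<omega>) (?v \<omega>)) = ip lam W W" .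
  have "inner (a + (\<Sum>j\<in>UNIV. Y j \<omega> *\<^sub>R b j) + W \<omega>) x
      = inner a x + (\<Sum>j\<in>UNIV. inner (b j) (Y j \<omega> *\<^sub>R x)) + inner (W \<omega>) x" for \<omega> x
    by (simp add: inner_add_left inner_sum_left)
  then have "ip lam (\<lambda>\<omega>. a + (\<Sum>j\<in>UNIV. Y j \<omega> *\<^sub>R b j) + W \<omega>) v
      = inner a (mean lam v) + (\<Sum>j\<in>UNIV. inner (b j) (mean lam (\<lambda>\<omega>. Y j \<omega> *\<^sub>R v \<omega>)))
        + mean lam (\<lambda>\<omega>. inner (W \<omega>) (v \<omega>))" for v
    by (simp only: ip_eq_mean mean_add mean_sum mean_inner_left)
  from this[of ?v] show ?thesis
    by (simp only: mean_v mean_Yv W_v)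
qed

text \<open>Matches the blocks of a test function with the equations of the scheme: the mean of
  \<open>G\<close>, its moments against the \<open>Y j\<close>, and its action on
  \<open>W\<close>.\<close>

lemma dual_pair_decomposition:
  "dual_pair lam G (\<lambda>\<omega>. a + (\<Sum>j\<in>UNIV. Y j \<omega> *\<^sub>R b j) + W \<omega>)
    = mean lam G a + (\<Sum>j\<in>UNIV. mean lam (\<lambda>\<omega>. Y j \<omega> *\<^sub>R G \<omega>) (b j)) + dual_pair lam G W"
  by (simp add: dual_pair_eq_mean mean_blinfun_apply blinfun.add_right blinfun.sum_right
      blinfun.scaleR_right blinfun.scaleR_left mean_add mean_sum)

text \<open>
  The new field and the increment are both of the form \<open>a + \<Sum>\<^sub>j Y\<^sub>j b\<^sub>j + W\<close>, where \<open>W\<close> is the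
  contribution of the increments of the stochastic modes.  The mode equation and the injectivity
  of \<open>\<iota>\<close> force \<open>W\<close> to be orthogonal to the constants and to all \<open>Y\<^sub>j\<close> even if the Gram matrix is
  singular, so that the three equations of the step decouple and add up.
\<close>

lemma dlr_step_tested:
  fixes \<iota> :: "'v::real_inner \<Rightarrow>\<^sub>L 'h::real_inner"
    and Y :: "'r::finite \<Rightarrow> 'w::finite \<Rightarrow> real"
  defines "field \<equiv> (dlr_field :: 'v \<Rightarrow> ('r \<Rightarrow> 'v) \<Rightarrow> ('r \<Rightarrow> 'w \<Rightarrow> real) \<Rightarrow> 'w \<Rightarrow> 'v)"
  assumes inj: "inj (blinfun_apply \<iota>)" and prob: "discrete_prob lam"
    and "subspace Vh" and dt: "dt \<noteq> 0"
    and state: "dlr_state lam Vh ub U Y"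
    and step: "dlr_step \<iota> lam Vh dt G ub U Y ub' U' Y'"
    and v: "v = field ub' U' Y' \<or> v = (\<lambda>\<omega>. field ub' U' Y' \<omega> - field ub U Y \<omega>)"
  shows "ip lam (\<lambda>\<omega>. \<iota> (field ub' U' Y' \<omega> - field ub U Y \<omega>)) (\<lambda>\<omega>. \<iota> (v \<omega>)) + dt * dual_pair lam G v = 0"
proof -
  have orth: "\<And>i j. ip lam (Y i) (Y j) = (if i = j then 1 else 0)"
    and Y_mean: "\<And>j. mean lam (Y j) = 0" and ub: "ub \<in> Vh" and U: "\<And>j. U j \<in> Vh"
    using state by (auto simp: dlr_state_def)
  have ub': "ub' \<in> Vh"
    and mean_eq: "\<And>v. v \<in> Vh \<Longrightarrow> inner (\<iota> ((1 / dt) *\<^sub>R (ub' - ub))) (\<iota> v) + mean lam G v = 0"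
    using step by (auto simp: dlr_step_def dlr_state_def)
  obtain Ut Yt where Ut: "\<And>j. Ut j \<in> Vh"
    and det_eq: "\<And>j v. v \<in> Vh \<Longrightarrow> inner (\<iota> ((1 / dt) *\<^sub>R (Ut j - U j))) (\<iota> v)
        + mean lam (\<lambda>\<omega>. Y j \<omega> *\<^sub>R G \<omega>) v = 0"
    and stoch_eq: "stoch_mode_eq \<iota> lam dt G Y Ut Yt"
    and reorth: "\<And>\<omega>. (\<Sum>j\<in>UNIV. Y' j \<omega> *\<^sub>R U' j) = (\<Sum>j\<in>UNIV. Yt j \<omega> *\<^sub>R Ut j)"
    using step unfolding dlr_step_def by blast
  define W where "W = (\<lambda>\<omega>. \<Sum>j\<in>UNIV. (Yt j \<omega> - Y j \<omega>) *\<^sub>R Ut j)"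
  \<comment> \<open>What remains of \<open>G\<close> without its mean and its components along the
    \<open>Y i\<close>; this is the part that drives \<open>W\<close>.\<close>
  define Q where "Q = (\<lambda>\<omega>. G \<omega> - mean lam G - (\<Sum>i\<in>UNIV. Y i \<omega> *\<^sub>R mean lam (\<lambda>\<omega>'. Y i \<omega>' *\<^sub>R G \<omega>')))"
  have W_Ut: "inner (\<iota> (W \<omega>)) (\<iota> (Ut j)) = - dt * Q \<omega> (Ut j)" for \<omega> j
    unfolding W_def Q_def by (rule stoch_mode_eq_inner[OF prob dt orth Y_mean stoch_eq])
  have mean_Q: "mean lam Q = 0"
    by (simp add: Q_def mean_diff mean_const[OF prob] mean_sum mean_scaleR_left Y_mean)
  have mean_YQ: "mean lam (\<lambda>\<omega>. Y i \<omega> *\<^sub>R Q \<omega>) = 0" for i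
  proof -
    let ?K = "\<lambda>j. mean lam (\<lambda>\<omega>'. Y j \<omega>' *\<^sub>R G \<omega>')"
    have "mean lam (\<lambda>\<omega>. Y i \<omega> *\<^sub>R Q \<omega>) = mean lam (\<lambda>\<omega>. Y i \<omega> *\<^sub>R G \<omega> - Y i \<omega> *\<^sub>R mean lam G
        - (\<Sum>j\<in>UNIV. (Y i \<omega> * Y j \<omega>) *\<^sub>R ?K j))"
      by (simp add: Q_def scaleR_diff_right scaleR_sum_right)
    also have "\<dots> = ?K i - (\<Sum>j\<in>UNIV. ip lam (Y i) (Y j) *\<^sub>R ?K j)"
      by (simp add: mean_diff mean_sum mean_scaleR_left Y_mean ip_eq_mean)
    also have "(\<Sum>j\<in>UNIV. ip lam (Y i) (Y j) *\<^sub>R ?K j) = ?K i"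
      by (simp add: orth if_distrib[of "\<lambda>c. c *\<^sub>R _"] cong: if_cong)
    finally show ?thesis by simp
  qed
  have lin: "linear (blinfun_apply \<iota>)"
    by (simp add: bounded_linear.linear blinfun.bounded_linear_right)
  \<comment> \<open>A weighted mean \<open>m\<close> of \<open>W\<close> is again a combination of
    the \<open>Ut j\<close>, while its \<open>H\<close>-product with each \<open>Ut j\<close> is a
    multiple of the same weighted mean of \<open>Q\<close>, here zero. So \<open>m\<close> is
    \<open>H\<close>-orthogonal to itself, and injectivity of \<open>\<iota>\<close> gives
    \<open>m = 0\<close>, also for linearly dependent \<open>Ut j\<close>.\<close>
  have weighted_zero: "mean lam (\<lambda>\<omega>. y \<omega> *\<^sub>R W \<omega>) = 0" if y: "mean lam (\<lambda>\<omega>. y \<omega> *\<^sub>R Q \<omega>) = 0" for y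
  proof -
    define m where "m = mean lam (\<lambda>\<omega>. y \<omega> *\<^sub>R W \<omega>)"
    have "m = (\<Sum>j\<in>UNIV. mean lam (\<lambda>\<omega>. y \<omega> * (Yt j \<omega> - Y j \<omega>)) *\<^sub>R Ut j)"
      by (simp add: m_def W_def scaleR_sum_right mean_sum mean_scaleR_left)
    then obtain c where m: "m = (\<Sum>j\<in>UNIV. c j *\<^sub>R Ut j)"
      by (rule that)
    have "inner (\<iota> m) (\<iota> (Ut j)) = mean lam (\<lambda>\<omega>. - dt * (y \<omega> *\<^sub>R Q \<omega>) (Ut j))" for j
      unfolding m_def
      by (simp add: mean_linear_image[OF lin, symmetric] mean_inner_right[symmetric]
          blinfun.scaleR_right blinfun.scaleR_left W_Ut mult_ac)
    then have "inner (\<iota> m) (\<iota> (Ut j)) = - dt * mean lam (\<lambda>\<omega>. y \<omega> *\<^sub>R Q \<omega>) (Ut j)" for j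
      by (simp only: mean_mult_left mean_blinfun_apply)
    then have "inner (\<iota> m) (\<iota> (Ut j)) = 0" for j
      by (simp add: y)
    then have "inner (\<iota> m) (\<iota> (\<Sum>j\<in>UNIV. c j *\<^sub>R Ut j)) = 0"
      by (simp add: blinfun.sum_right blinfun.scaleR_right inner_sum_right)
    then have "\<iota> m = \<iota> 0"
      by (simp flip: m)
    then show ?thesis
      using inj unfolding m_def by (blast dest: injD)
  qed
  have W_mean: "mean lam W = 0"
    using weighted_zero[of "\<lambda>_. 1"] mean_Q by simp
  have YW_mean: "mean lam (\<lambda>\<omega>. Y i \<omega> *\<^sub>R W \<omega>) = 0" for i
    by (rule weighted_zero[OF mean_YQ])
  \<comment> \<open>At each sample point \<open>W \<omega>\<close> is itself a combination of the
    \<open>Ut j\<close>, so it can serve as its own test vector.\<close>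
  have "inner (\<iota> (W \<omega>)) (\<iota> (W \<omega>)) = - dt * Q \<omega> (W \<omega>)" for \<omega>
  proof -
    have "inner (\<iota> (W \<omega>)) (\<iota> (\<Sum>j\<in>UNIV. (Yt j \<omega> - Y j \<omega>) *\<^sub>R Ut j))
        = - dt * Q \<omega> (\<Sum>j\<in>UNIV. (Yt j \<omega> - Y j \<omega>) *\<^sub>R Ut j)"
      by (simp add: blinfun.sum_right blinfun.scaleR_right inner_sum_right W_Ut sum_distrib_left
          sum_negf mult_ac)
    then show ?thesis by (simp add: W_def)
  qed
  then have "ip lam (\<lambda>\<omega>. \<iota> (W \<omega>)) (\<lambda>\<omega>. \<iota> (W \<omega>)) = - dt * dual_pair lam Q W"
    by (simp only: ip_eq_mean dual_pair_eq_mean mean_mult_left)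
  \<comment> \<open>The components removed from \<open>G\<close> pair only with the means of
    \<open>W\<close> and of \<open>Y i\<close> times \<open>W\<close>, all of which vanish.\<close>
  also have "dual_pair lam Q W = dual_pair lam G W"
  proof -
    have "dual_pair lam Q W = mean lam (\<lambda>\<omega>. G \<omega> (W \<omega>) - mean lam G (W \<omega>)
        - (\<Sum>i\<in>UNIV. mean lam (\<lambda>\<omega>'. Y i \<omega>' *\<^sub>R G \<omega>') (Y i \<omega> *\<^sub>R W \<omega>)))"
      by (simp add: dual_pair_eq_mean Q_def blinfun.diff_left blinfun.sum_left blinfun.scaleR_left
          blinfun.scaleR_right)
    also have "\<dots> = dual_pair lam G W"
      by (simp only: mean_diff mean_sum dual_pair_eq_mean W_mean YW_mean
        mean_linear_image[OF bounded_linear.linear[OF blinfun.bounded_linear_right]]) simp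
    finally show ?thesis .
  qed
  finally have W_W: "ip lam (\<lambda>\<omega>. \<iota> (W \<omega>)) (\<lambda>\<omega>. \<iota> (W \<omega>)) = - dt * dual_pair lam G W" .
  \<comment> \<open>Reorthonormalization preserves the product of modes and coefficients, which
    splits into old modes with the new coefficients \<open>Ut j\<close>, plus
    \<open>W\<close>.\<close>
  have decomp: "field ub' U' Y' = (\<lambda>\<omega>. ub' + (\<Sum>j\<in>UNIV. Y j \<omega> *\<^sub>R Ut j) + W \<omega>)"
    by (simp add: field_def dlr_field_def reorth W_def scaleR_diff_left sum_subtractf)
  then have diff: "(\<lambda>\<omega>. field ub' U' Y' \<omega> - field ub U Y \<omega>)
      = (\<lambda>\<omega>. (ub' - ub) + (\<Sum>j\<in>UNIV. Y j \<omega> *\<^sub>R (Ut j - U j)) + W \<omega>)"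
    by (simp add: field_def dlr_field_def scaleR_diff_right sum_subtractf algebra_simps)
  \<comment> \<open>Both test functions share the block \<open>W\<close>; their other coefficients
    lie in \<open>Vh\<close> and are therefore admissible in the first two equations of the
    step.\<close>
  obtain a b where a: "a \<in> Vh" and b: "\<And>j. b j \<in> Vh"
    and v_eq: "v = (\<lambda>\<omega>. a + (\<Sum>j\<in>UNIV. Y j \<omega> *\<^sub>R b j) + W \<omega>)"
    using v
  proof
    assume "v = field ub' U' Y'"
    with that[OF ub' Ut] decomp show thesis by simp
  next
    assume "v = (\<lambda>\<omega>. field ub' U' Y' \<omega> - field ub U Y \<omega>)"
    with that[of "ub' - ub" "\<lambda>j. Ut j - U j"] diff show thesis
      using \<open>subspace Vh\<close> ub ub' U Ut by (simp add: subspace_diff)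
  qed
  have "mean lam (\<lambda>\<omega>. \<iota> (W \<omega>)) = 0" "mean lam (\<lambda>\<omega>. Y i \<omega> *\<^sub>R \<iota> (W \<omega>)) = 0" for i
    using mean_linear_image[OF lin, of lam W] mean_linear_image[OF lin, of lam "\<lambda>\<omega>. Y i \<omega> *\<^sub>R W \<omega>"]
    by (simp_all add: W_mean YW_mean blinfun.scaleR_right)
  note ip_decomp = ip_orthogonal_decomposition[OF prob orth Y_mean this]
  have unscale: "inner (\<iota> x) y = - dt * g" if "inner (\<iota> ((1 / dt) *\<^sub>R x)) y + g = 0" for x y g
    using that dt by (simp add: blinfun.scaleR_right field_simps)
  have "ip lam (\<lambda>\<omega>. \<iota> (field ub' U' Y' \<omega> - field ub U Y \<omega>)) (\<lambda>\<omega>. \<iota> (v \<omega>))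
      = ip lam (\<lambda>\<omega>. \<iota> (ub' - ub) + (\<Sum>j\<in>UNIV. Y j \<omega> *\<^sub>R \<iota> (Ut j - U j)) + \<iota> (W \<omega>))
          (\<lambda>\<omega>. \<iota> a + (\<Sum>j\<in>UNIV. Y j \<omega> *\<^sub>R \<iota> (b j)) + \<iota> (W \<omega>))"
    using fun_cong[OF diff] by (simp add: v_eq blinfun.add_right blinfun.sum_right blinfun.scaleR_right)
  also have "\<dots> = inner (\<iota> (ub' - ub)) (\<iota> a) + (\<Sum>j\<in>UNIV. inner (\<iota> (Ut j - U j)) (\<iota> (b j)))
      - dt * dual_pair lam G W"
    by (simp add: ip_decomp W_W)
  also have "inner (\<iota> (ub' - ub)) (\<iota> a) = - dt * mean lam G a"
    by (rule unscale[OF mean_eq[OF a]])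
  also have "(\<Sum>j\<in>UNIV. inner (\<iota> (Ut j - U j)) (\<iota> (b j)))
      = (\<Sum>j\<in>UNIV. - dt * mean lam (\<lambda>\<omega>. Y j \<omega> *\<^sub>R G \<omega>) (b j))"
    by (intro sum.cong refl unscale det_eq b)
  finally show ?thesis
    unfolding v_eq dual_pair_decomposition
    by (simp add: sum_distrib_left sum_negf distrib_left)
qed

lemma dlr_state_in_tensor_space:
  assumes "subspace Vh" "dlr_state lam Vh ub U Y"
  shows "dlr_field ub U Y \<in> tensor_space Vh"
  using assms unfolding tensor_space_def dlr_field_def dlr_state_def
  by (auto intro!: subspace_add subspace_sum subspace_scale)

text \<open>The terms \<open>b n\<close> may have any sign, so dissipation can be carried in them
  with a minus sign.\<close>

lemma telescope_bound:
  fixes a b :: "nat \<Rightarrow> real"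
  assumes "\<And>n. n < N \<Longrightarrow> a (Suc n) \<le> a n + b n"
  shows "a N \<le> a 0 + (\<Sum>n<N. b n)"
  using assms by (induction N) (auto, fastforce)

theorem theorem5p6:
  fixes \<iota> :: "'v::{real_inner,complete_space,second_countable_topology}
                 \<Rightarrow>\<^sub>L 'h::{real_inner,complete_space,second_countable_topology}"
    and lam :: "'w::finite \<Rightarrow> real"
    and L :: "'w \<Rightarrow> 'v \<Rightarrow> ('v \<Rightarrow>\<^sub>L real)"
    and Ldet :: "'v \<Rightarrow> ('v \<Rightarrow>\<^sub>L real)"
    and Lstoch :: "'w \<Rightarrow> 'v \<Rightarrow> ('v \<Rightarrow>\<^sub>L real)"
    and Vh :: "'v set"
    and f :: "real \<Rightarrow> 'w \<Rightarrow> 'h"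
    and F :: "nat \<Rightarrow> 'w \<Rightarrow> 'h"
    and ub :: "nat \<Rightarrow> 'v"
    and U :: "nat \<Rightarrow> 'r::finite \<Rightarrow> 'v"
    and Y :: "nat \<Rightarrow> 'r \<Rightarrow> 'w \<Rightarrow> real"
    and u :: "nat \<Rightarrow> 'w \<Rightarrow> 'v"
    and CP CL CB Cdet Cstoch CI h T dt :: real
    and p N :: nat
  assumes gelfand: "gelfand_triple \<iota> CP"
    and prob: "discrete_prob lam"
    and L_linear: "\<And>\<omega>. linear (L \<omega>)"
    and CL_pos: "CL > 0" and CB_pos: "CB > 0"
    and L_coercive: "\<And>\<omega> v. L \<omega> v v \<ge> CL * (norm v)\<^sup>2"
    and L_bounded: "\<And>\<omega> v w. L \<omega> v w \<le> CB * norm v * norm w"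
    and splitting: "\<And>\<omega> v. L \<omega> v = Ldet v + Lstoch \<omega> v"
    and Ldet_linear: "linear Ldet"
    and Ldet_bounded: "\<exists>B. \<forall>v w. \<bar>Ldet v w\<bar> \<le> B * norm v * norm w"
    and Ldet_coercive: "\<exists>c>0. \<forall>v. Ldet v v \<ge> c * (norm v)\<^sup>2"
    and Vh_subspace: "subspace Vh"
    and Vh_finite_dim: "\<exists>B. finite B \<and> span B = Vh"
    and Vh_dim: "dim Vh > CARD('r)"
    and R_less: "CARD('r) < CARD('w)"
    and h_pos: "h > 0" and CI_pos: "CI > 0"
    and inverse_ineq: "\<And>v. v \<in> tensor_space Vh \<Longrightarrow> nrm lam v \<le> CI / h ^ p * nrmH \<iota> lam v"
    and T_pos: "T > 0" and N_pos: "N > 0" and dt_eq: "dt = T / real N"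
    and rhs: "rhs_eval f dt N F"
    and Cdet_pos: "Cdet > 0" and Cstoch_pos: "Cstoch > 0"
    and Cdet_bound: "\<And>v. v \<in> tensor_space Vh \<Longrightarrow>
          op_ip lam (\<lambda>_. Ldet) v v \<ge> Cdet * op_ip lam L v v"
    and Cstoch_bound: "\<And>v w. v \<in> tensor_space Vh \<Longrightarrow> w \<in> tensor_space Vh \<Longrightarrow>
          \<bar>dual_pair lam (apply_op Lstoch v) w\<bar> \<le> Cstoch * nrm lam v * nrm lam w"
    and solution: "dlr_solution \<iota> lam Vh (semi_implicit Ldet Lstoch) F dt N ub U Y u"
  shows
    "(\<forall>\<kappa>>0. dt / h ^ (2 * p) \<le> \<kappa> * CL / (CI\<^sup>2 * Cstoch\<^sup>2) \<longrightarrow>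
        (nrmH \<iota> lam (u N))\<^sup>2 + dt * CL * (1 - \<kappa>) * (\<Sum>n<N. (nrm lam (u (Suc n)))\<^sup>2)
          \<le> (nrmH \<iota> lam (u 0))\<^sup>2 + dt * CP\<^sup>2 / CL * (\<Sum>n<N. (nrm lam (F n))\<^sup>2)) \<and>
     (symmetric_op L \<longrightarrow>
        (\<forall>\<kappa>. 0 < \<kappa> \<and> \<kappa> < 2 \<and>
           (Cdet \<ge> 1 / 2 \<or>
            Cdet < 1 / 2 \<and> dt / h ^ (2 * p) \<le> (2 - \<kappa>) / (CI\<^sup>2 * CB * (1 - 2 * Cdet))) \<longrightarrow>
           (op_nrm lam L (u N))\<^sup>2
             \<le> (op_nrm lam L (u 0))\<^sup>2 + dt / \<kappa> * (\<Sum>n<N. (nrm lam (F n))\<^sup>2))) \<and>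
     ((\<forall>t\<in>{0..T}. \<forall>\<omega>. f t \<omega> = 0) \<and> symmetric_op L \<and>
        (Cdet \<ge> 1 / 2 \<or>
         Cdet < 1 / 2 \<and> dt / h ^ (2 * p) \<le> 2 / (CI\<^sup>2 * CB * (1 - 2 * Cdet))) \<longrightarrow>
        (\<forall>n<N. op_nrm lam L (u (Suc n)) \<le> op_nrm lam L (u n)))"
proof -

  \<comment> \<open>Norm comparisons, step size restriction and the tested scheme\<close>
  have inj: "inj (blinfun_apply \<iota>)" and "CP > 0" and CP: "\<And>v. norm (\<iota> v) \<le> CP * norm v"
    using gelfand by (auto simp: gelfand_triple_def)
  have dt: "dt > 0"
    using T_pos N_pos dt_eq by simp
  have L_add: "L \<omega> (v + w) = L \<omega> v + L \<omega> w" and L_diff: "L \<omega> (v - w) = L \<omega> v - L \<omega> w" for \<omega> v w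
    using L_linear by (simp_all add: linear_add linear_diff)
  have Ldet_diff: "Ldet (v - w) = Ldet v - Ldet w" for v w
    using Ldet_linear by (simp add: linear_diff)
  have Lstoch_eq: "Lstoch \<omega> v = L \<omega> v - Ldet v" for \<omega> v
    by (simp add: splitting)
  have nrmH_sq: "(nrmH \<iota> lam v)\<^sup>2 = ip lam (\<lambda>\<omega>. \<iota> (v \<omega>)) (\<lambda>\<omega>. \<iota> (v \<omega>))" for v :: "'w \<Rightarrow> 'v"
    by (simp add: nrmH_def nrm_sq[OF prob])
  have op_ip_lower: "CL * (nrm lam v)\<^sup>2 \<le> op_ip lam L v v" for v
    unfolding nrm_sq[OF prob] op_ip_def dual_pair_eq_mean ip_eq_mean apply_op_def mean_mult_left[symmetric]
    by (rule mean_mono[OF prob]) (use L_coercive in \<open>simp add: power2_norm_eq_inner\<close>)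
  have op_ip_upper: "op_ip lam L v v \<le> CB * (nrm lam v)\<^sup>2" for v
    unfolding nrm_sq[OF prob] op_ip_def dual_pair_eq_mean ip_eq_mean apply_op_def mean_mult_left[symmetric]
  proof (rule mean_mono[OF prob])
    fix \<omega>
    show "L \<omega> (v \<omega>) (v \<omega>) \<le> CB * inner (v \<omega>) (v \<omega>)"
      using L_bounded[of \<omega> "v \<omega>" "v \<omega>"] by (simp add: power2_norm_eq_inner[symmetric] power2_eq_square mult_ac)
  qed
  have op_ip_nonneg: "0 \<le> op_ip lam L v v" for v
    by (rule order_trans[OF _ op_ip_lower]) (simp add: CL_pos less_imp_le)
  then have op_nrm_sq: "(op_nrm lam L v)\<^sup>2 = op_ip lam L v v" for v
    by (simp add: op_nrm_def)
  have poincare: "(nrmH \<iota> lam v)\<^sup>2 \<le> CP\<^sup>2 * (nrm lam v)\<^sup>2" for v :: "'w \<Rightarrow> 'v"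
    unfolding nrmH_sq nrm_sq[OF prob] ip_eq_mean mean_mult_left[symmetric]
  proof (rule mean_mono[OF prob])
    fix \<omega>
    have "(norm (\<iota> (v \<omega>)))\<^sup>2 \<le> (CP * norm (v \<omega>))\<^sup>2"
      using CP by (intro power_mono) auto
    then show "inner (\<iota> (v \<omega>)) (\<iota> (v \<omega>)) \<le> CP\<^sup>2 * inner (v \<omega>) (v \<omega>)"
      by (simp add: power2_norm_eq_inner power_mult_distrib)
  qed
  \<comment> \<open>The factor of the inverse inequality; every step size restriction is used as a
    bound on \<open>dt * s\<^sup>2\<close>.\<close>
  define s where "s = CI / h ^ p"
  have s: "s > 0"
    using CI_pos h_pos by (simp add: s_def)
  have dt_s: "dt * s\<^sup>2 \<le> c" if "dt / h ^ (2 * p) \<le> c / CI\<^sup>2" for c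
  proof -
    have "dt * s\<^sup>2 = dt / h ^ (2 * p) * CI\<^sup>2"
      by (simp add: s_def power_divide power_mult[symmetric] mult.commute)
    also have "\<dots> \<le> c / CI\<^sup>2 * CI\<^sup>2"
      by (rule mult_right_mono[OF that]) simp
    finally show ?thesis
      using CI_pos by simp
  qed
  have inverse_sq: "(nrm lam v)\<^sup>2 \<le> s\<^sup>2 * (nrmH \<iota> lam v)\<^sup>2" if "v \<in> tensor_space Vh" for v
    using power_mono[OF inverse_ineq[OF that] nrm_nonneg[OF prob], of 2]
    by (simp add: s_def power_mult_distrib power_divide)

  define d where "d n = (\<lambda>\<omega>. u (Suc n) \<omega> - u n \<omega>)" for n
  have step: "dlr_step \<iota> lam Vh dt
      (\<lambda>\<omega>. semi_implicit Ldet Lstoch (u n) (u (Suc n)) \<omega> - H_to_dual \<iota> (F n \<omega>))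
      (ub n) (U n) (Y n) (ub (Suc n)) (U (Suc n)) (Y (Suc n))" if "n < N" for n
    using solution that unfolding dlr_solution_def by blast
  have state: "dlr_state lam Vh (ub n) (U n) (Y n)" if "n \<le> N" for n
  proof (cases n)
    case 0
    then show ?thesis
      using solution by (simp add: dlr_solution_def)
  next
    case (Suc m)
    then show ?thesis
      using step[of m] that by (simp add: dlr_step_def)
  qed
  have u_eq: "u n = dlr_field (ub n) (U n) (Y n)" if "n \<le> N" for n
    using solution that by (simp add: dlr_solution_def)
  have u_mem: "u n \<in> tensor_space Vh" if "n \<le> N" for n
    using dlr_state_in_tensor_space[OF Vh_subspace state[OF that]] u_eq[OF that] by simp
  have d_mem: "d n \<in> tensor_space Vh" if "n < N" for n
    using u_mem[of n] u_mem[of "Suc n"] that Vh_subspace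
    by (simp add: tensor_space_def d_def subspace_diff)
  have tested: "ip lam (\<lambda>\<omega>. \<iota> (d n \<omega>)) (\<lambda>\<omega>. \<iota> (v \<omega>))
      + dt * mean lam (\<lambda>\<omega>. Ldet (u (Suc n) \<omega>) (v \<omega>) + Lstoch \<omega> (u n \<omega>) (v \<omega>) - inner (F n \<omega>) (\<iota> (v \<omega>))) = 0"
    if n: "n < N" and v: "v = u (Suc n) \<or> v = d n" for n v
  proof -
    have "u n = dlr_field (ub n) (U n) (Y n)" "u (Suc n) = dlr_field (ub (Suc n)) (U (Suc n)) (Y (Suc n))"
      using n by (simp_all add: u_eq)
    then show ?thesis
      using dlr_step_tested[OF inj prob Vh_subspace _ state step[OF n], of v] n v dt
      by (simp add: d_def dual_pair_eq_mean semi_implicit_def H_to_dual_def blinfun.diff_left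
          blinfun.add_left)
  qed

  \<comment> \<open>The \<open>H\<close>-norm estimate for one step\<close>
  have energy_H: "(nrmH \<iota> lam (u (Suc n)))\<^sup>2 + dt * CL * (1 - \<kappa>) * (nrm lam (u (Suc n)))\<^sup>2
      \<le> (nrmH \<iota> lam (u n))\<^sup>2 + dt * CP\<^sup>2 / CL * (nrm lam (F n))\<^sup>2"
    if n: "n < N" and "\<kappa> > 0" and cfl: "dt / h ^ (2 * p) \<le> \<kappa> * CL / (CI\<^sup>2 * Cstoch\<^sup>2)" for n \<kappa>
  proof -
    let ?X = "nrm lam (u (Suc n))" and ?D = "nrmH \<iota> lam (d n)"
    let ?S = "dual_pair lam (apply_op Lstoch (d n)) (u (Suc n))"
    let ?f = "ip lam (F n) (\<lambda>\<omega>. \<iota> (u (Suc n) \<omega>))"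
    \<comment> \<open>Writing \<open>Lstoch\<close> at \<open>u n\<close> as its value at
      \<open>u (Suc n)\<close> minus that at \<open>d n\<close> completes the coercive operator
      \<open>L\<close> at the new field; only the term in \<open>d n\<close> has to be
      absorbed.\<close>
    have "mean lam (\<lambda>\<omega>. Ldet (u (Suc n) \<omega>) (u (Suc n) \<omega>) + Lstoch \<omega> (u n \<omega>) (u (Suc n) \<omega>)
        - inner (F n \<omega>) (\<iota> (u (Suc n) \<omega>)))
      = mean lam (\<lambda>\<omega>. L \<omega> (u (Suc n) \<omega>) (u (Suc n) \<omega>) - Lstoch \<omega> (d n \<omega>) (u (Suc n) \<omega>)
        - inner (F n \<omega>) (\<iota> (u (Suc n) \<omega>)))"
      by (simp add: Lstoch_eq d_def L_diff Ldet_diff blinfun.diff_left blinfun.add_left algebra_simps)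
    also have "\<dots> = op_ip lam L (u (Suc n)) (u (Suc n)) - ?S - ?f"
      by (simp add: mean_diff op_ip_def dual_pair_eq_mean apply_op_def ip_eq_mean)
    finally have "ip lam (\<lambda>\<omega>. \<iota> (d n \<omega>)) (\<lambda>\<omega>. \<iota> (u (Suc n) \<omega>))
        + dt * (op_ip lam L (u (Suc n)) (u (Suc n)) - ?S - ?f) = 0"
      using tested[OF n, of "u (Suc n)"] by simp
    moreover have "2 * ip lam (\<lambda>\<omega>. \<iota> (d n \<omega>)) (\<lambda>\<omega>. \<iota> (u (Suc n) \<omega>))
        = (nrmH \<iota> lam (u (Suc n)))\<^sup>2 - (nrmH \<iota> lam (u n))\<^sup>2 + ?D\<^sup>2"
      unfolding nrmH_sq d_def blinfun.diff_right by (rule ip_polarization)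
    moreover have "dt * (CL * ?X\<^sup>2) \<le> dt * op_ip lam L (u (Suc n)) (u (Suc n))"
      using op_ip_lower dt by (simp add: mult_left_mono)
    \<comment> \<open>Young with weight 1 spends exactly the \<open>?D\<^sup>2 / 2\<close> supplied
      by polarization. The other term contains \<open>dt * s\<^sup>2\<close>, where the restriction
      enters.\<close>
    moreover have "dt * ?S \<le> ?D\<^sup>2 / 2 + dt * \<kappa> * CL * ?X\<^sup>2 / 2"
    proof -
      have "?S \<le> Cstoch * nrm lam (d n) * ?X"
        using Cstoch_bound[OF d_mem[OF n] u_mem, of "Suc n"] n by simp
      also have "\<dots> \<le> Cstoch * (s * ?D) * ?X"
        using inverse_ineq[OF d_mem[OF n]] Cstoch_pos nrm_nonneg[OF prob]
        by (intro mult_right_mono mult_left_mono) (simp_all add: s_def)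
      finally have "dt * ?S \<le> ?D * (dt * Cstoch * s * ?X)"
        using dt by (simp add: mult_ac)
      also have "\<dots> \<le> ?D\<^sup>2 / 2 + (dt * Cstoch * s * ?X)\<^sup>2 / 2"
        using young[of 1 ?D] by simp
      also have "(dt * Cstoch * s * ?X)\<^sup>2 = dt * s\<^sup>2 * (dt * Cstoch\<^sup>2 * ?X\<^sup>2)"
        by (simp add: power2_eq_square mult_ac)
      also have "\<dots> \<le> \<kappa> * CL / Cstoch\<^sup>2 * (dt * Cstoch\<^sup>2 * ?X\<^sup>2)"
        using cfl dt by (intro mult_right_mono dt_s) (simp_all add: mult.commute)
      finally show ?thesis
        using Cstoch_pos by (simp add: mult_ac)
    qed
    \<comment> \<open>The weight is chosen so that the Poincare-type bound leaves
      \<open>CL / 2\<close> in front of \<open>?X\<^sup>2\<close>. After doubling, the coefficients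
      of \<open>dt * CL * ?X\<^sup>2\<close> combine to 2 - \<kappa> - 1 = 1 - \<kappa>.\<close>
    moreover have "?f \<le> CP\<^sup>2 / CL / 2 * (nrm lam (F n))\<^sup>2 + CL / 2 * ?X\<^sup>2"
    proof -
      let ?c = "CP\<^sup>2 / CL"
      have "?f \<le> ?c / 2 * (nrm lam (F n))\<^sup>2 + 1 / (2 * ?c) * (nrmH \<iota> lam (u (Suc n)))\<^sup>2"
        unfolding nrmH_def using \<open>CP > 0\<close> CL_pos by (intro ip_young[OF prob]) simp
      also have "1 / (2 * ?c) * (nrmH \<iota> lam (u (Suc n)))\<^sup>2 \<le> 1 / (2 * ?c) * (CP\<^sup>2 * ?X\<^sup>2)"
        using CL_pos by (intro mult_left_mono poincare) simp
      also have "\<dots> = CL / 2 * ?X\<^sup>2"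
        using \<open>CP > 0\<close> CL_pos by simp
      finally show ?thesis by simp
    qed
    then have "dt * ?f \<le> dt * (CP\<^sup>2 / CL / 2 * (nrm lam (F n))\<^sup>2 + CL / 2 * ?X\<^sup>2)"
      using dt by simp
    ultimately show ?thesis
      by (simp add: algebra_simps)
  qed

  \<comment> \<open>The energy estimate for one step with symmetric \<open>L\<close>\<close>
  \<comment> \<open>The source term is left unestimated and \<kappa> = 0 is allowed, so that one
    inequality serves both energy claims; \<kappa> is the share of the dissipation
    \<open>2 * ?D\<^sup>2\<close> kept in reserve.\<close>
  have energy_L: "dt * (op_ip lam L (u (Suc n)) (u (Suc n)) - op_ip lam L (u n) (u n))
      \<le> 2 * dt * ip lam (F n) (\<lambda>\<omega>. \<iota> (d n \<omega>)) - \<kappa> * (nrmH \<iota> lam (d n))\<^sup>2"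
    if n: "n < N" and sym: "symmetric_op L" and "\<kappa> \<le> 2"
      and cfl: "Cdet \<ge> 1 / 2 \<or>
        Cdet < 1 / 2 \<and> dt / h ^ (2 * p) \<le> (2 - \<kappa>) / (CI\<^sup>2 * CB * (1 - 2 * Cdet))" for n \<kappa>
  proof -
    let ?D = "nrmH \<iota> lam (d n)" and ?q = "op_ip lam L (d n) (d n)"
    let ?f = "ip lam (F n) (\<lambda>\<omega>. \<iota> (d n \<omega>))"
    \<comment> \<open>The operator side is \<open>L\<close> at \<open>u n\<close> plus
      \<open>Ldet\<close> at \<open>d n\<close>. Polarizing the first term leaves the energy of
      \<open>d n\<close> with a minus sign, to be compensated by \<open>Ldet\<close>.\<close>
    have "2 * (Ldet (u (Suc n) \<omega>) (d n \<omega>) + Lstoch \<omega> (u n \<omega>) (d n \<omega>))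
        = L \<omega> (u (Suc n) \<omega>) (u (Suc n) \<omega>) - L \<omega> (u n \<omega>) (u n \<omega>) - L \<omega> (d n \<omega>) (d n \<omega>)
          + 2 * Ldet (d n \<omega>) (d n \<omega>)" for \<omega>
    proof -
      have "L \<omega> (u (Suc n) \<omega>) (u n \<omega>) = L \<omega> (u n \<omega>) (u (Suc n) \<omega>)"
        using sym by (simp add: symmetric_op_def)
      then show ?thesis
        by (simp add: Lstoch_eq d_def L_diff Ldet_diff blinfun.diff_left blinfun.diff_right)
    qed
    then have "2 * (Ldet (u (Suc n) \<omega>) (d n \<omega>) + Lstoch \<omega> (u n \<omega>) (d n \<omega>) - inner (F n \<omega>) (\<iota> (d n \<omega>)))
        = L \<omega> (u (Suc n) \<omega>) (u (Suc n) \<omega>) - L \<omega> (u n \<omega>) (u n \<omega>) - L \<omega> (d n \<omega>) (d n \<omega>)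
          + 2 * Ldet (d n \<omega>) (d n \<omega>) - 2 * inner (F n \<omega>) (\<iota> (d n \<omega>))" for \<omega>
      by (simp add: right_diff_distrib)
    then have twice: "2 * mean lam (\<lambda>\<omega>. Ldet (u (Suc n) \<omega>) (d n \<omega>) + Lstoch \<omega> (u n \<omega>) (d n \<omega>)
          - inner (F n \<omega>) (\<iota> (d n \<omega>)))
        = op_ip lam L (u (Suc n)) (u (Suc n)) - op_ip lam L (u n) (u n) - ?q
          + 2 * op_ip lam (\<lambda>_. Ldet) (d n) (d n) - 2 * ?f"
      unfolding mean_mult_left[symmetric]
      by (simp only: mean_add mean_diff op_ip_def dual_pair_eq_mean apply_op_def ip_eq_mean mean_mult_left)
    have "2 * ?D\<^sup>2 + dt * (op_ip lam L (u (Suc n)) (u (Suc n)) - op_ip lam L (u n) (u n) - ?q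
          + 2 * op_ip lam (\<lambda>_. Ldet) (d n) (d n) - 2 * ?f) = 0"
      unfolding nrmH_sq twice[symmetric] using tested[OF n disjI2[OF refl]] by algebra
    moreover have "dt * (2 * Cdet * ?q) \<le> dt * (2 * op_ip lam (\<lambda>_. Ldet) (d n) (d n))"
      using Cdet_bound[OF d_mem[OF n]] dt by (intro mult_left_mono) simp_all
    \<comment> \<open>The deficit left after the lower bound on \<open>Ldet\<close>. It is
      nonpositive if \<open>Cdet \<ge> 1 / 2\<close>, whence no restriction; otherwise boundedness
      of \<open>L\<close> and the inverse inequality reduce it to the dissipation.\<close>
    moreover have "dt * ((1 - 2 * Cdet) * ?q) \<le> (2 - \<kappa>) * ?D\<^sup>2"
    proof (cases "Cdet \<ge> 1 / 2")
      case True
      then have "dt * ((1 - 2 * Cdet) * ?q) \<le> 0"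
        using dt op_ip_nonneg by (simp add: mult_nonneg_nonpos mult_nonpos_nonneg)
      also have "0 \<le> (2 - \<kappa>) * ?D\<^sup>2"
        using \<open>\<kappa> \<le> 2\<close> by simp
      finally show ?thesis .
    next
      case False
      then have pos: "0 < CB * (1 - 2 * Cdet)"
        using CB_pos by simp
      have "?q \<le> CB * (s\<^sup>2 * ?D\<^sup>2)"
        using inverse_sq[OF d_mem[OF n]] CB_pos
        by (intro order_trans[OF op_ip_upper] mult_left_mono) simp_all
      then have "dt * ((1 - 2 * Cdet) * ?q) \<le> dt * ((1 - 2 * Cdet) * (CB * (s\<^sup>2 * ?D\<^sup>2)))"
        using False dt by (intro mult_left_mono) simp_all
      also have "\<dots> = dt * s\<^sup>2 * (CB * (1 - 2 * Cdet)) * ?D\<^sup>2"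
        by (simp add: mult_ac)
      also have "\<dots> \<le> (2 - \<kappa>) / (CB * (1 - 2 * Cdet)) * (CB * (1 - 2 * Cdet)) * ?D\<^sup>2"
      proof (intro mult_right_mono dt_s)
        show "dt / h ^ (2 * p) \<le> (2 - \<kappa>) / (CB * (1 - 2 * Cdet)) / CI\<^sup>2"
          using cfl False by (simp add: mult.assoc mult.commute[of "CI\<^sup>2"])
      qed (use pos in simp_all)
      also have "\<dots> = (2 - \<kappa>) * ?D\<^sup>2"
        using False CB_pos by simp
      finally show ?thesis .
    qed
    ultimately show ?thesis
      by (simp add: algebra_simps)
  qed

  \<comment> \<open>Summation over the time steps and the three claims\<close>
  show ?thesis
  proof (intro conjI allI impI)
    fix \<kappa> :: real
    assume "\<kappa> > 0" and cfl: "dt / h ^ (2 * p) \<le> \<kappa> * CL / (CI\<^sup>2 * Cstoch\<^sup>2)"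
    have "(nrmH \<iota> lam (u N))\<^sup>2 \<le> (nrmH \<iota> lam (u 0))\<^sup>2
        + (\<Sum>n<N. dt * CP\<^sup>2 / CL * (nrm lam (F n))\<^sup>2 - dt * CL * (1 - \<kappa>) * (nrm lam (u (Suc n)))\<^sup>2)"
    proof (rule telescope_bound)
      fix n
      assume "n < N"
      from energy_H[OF this \<open>\<kappa> > 0\<close> cfl]
      show "(nrmH \<iota> lam (u (Suc n)))\<^sup>2 \<le> (nrmH \<iota> lam (u n))\<^sup>2
          + (dt * CP\<^sup>2 / CL * (nrm lam (F n))\<^sup>2 - dt * CL * (1 - \<kappa>) * (nrm lam (u (Suc n)))\<^sup>2)"
        by linarith
    qed
    then show "(nrmH \<iota> lam (u N))\<^sup>2 + dt * CL * (1 - \<kappa>) * (\<Sum>n<N. (nrm lam (u (Suc n)))\<^sup>2)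
        \<le> (nrmH \<iota> lam (u 0))\<^sup>2 + dt * CP\<^sup>2 / CL * (\<Sum>n<N. (nrm lam (F n))\<^sup>2)"
      by (simp add: sum_subtractf sum_distrib_left)
  next
    fix \<kappa> :: real
    assume sym: "symmetric_op L" and \<kappa>: "0 < \<kappa> \<and> \<kappa> < 2 \<and> (Cdet \<ge> 1 / 2 \<or>
      Cdet < 1 / 2 \<and> dt / h ^ (2 * p) \<le> (2 - \<kappa>) / (CI\<^sup>2 * CB * (1 - 2 * Cdet)))"
    have "op_ip lam L (u (Suc n)) (u (Suc n)) \<le> op_ip lam L (u n) (u n) + dt / \<kappa> * (nrm lam (F n))\<^sup>2"
      if n: "n < N" for n
    proof -
      \<comment> \<open>With weight \<open>dt / \<kappa>\<close>, multiplication by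
        \<open>2 * dt\<close> gives the squared \<open>H\<close>-norm of \<open>d n\<close> the
        factor \<kappa>, which cancels the reserve in \<open>energy_L\<close>.\<close>
      have "ip lam (F n) (\<lambda>\<omega>. \<iota> (d n \<omega>))
          \<le> dt / \<kappa> / 2 * (nrm lam (F n))\<^sup>2 + 1 / (2 * (dt / \<kappa>)) * (nrmH \<iota> lam (d n))\<^sup>2"
        unfolding nrmH_def using \<kappa> dt by (intro ip_young[OF prob]) simp
      then have "2 * dt * ip lam (F n) (\<lambda>\<omega>. \<iota> (d n \<omega>))
          \<le> 2 * dt * (dt / \<kappa> / 2 * (nrm lam (F n))\<^sup>2 + 1 / (2 * (dt / \<kappa>)) * (nrmH \<iota> lam (d n))\<^sup>2)"
        using dt by simp
      also have "\<dots> = dt * (dt / \<kappa> * (nrm lam (F n))\<^sup>2) + \<kappa> * (nrmH \<iota> lam (d n))\<^sup>2"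
        using dt \<kappa> by (simp add: field_simps)
      finally have "dt * (op_ip lam L (u (Suc n)) (u (Suc n)) - op_ip lam L (u n) (u n))
          \<le> dt * (dt / \<kappa> * (nrm lam (F n))\<^sup>2)"
        using energy_L[OF n sym, of \<kappa>] \<kappa> by linarith
      then have "op_ip lam L (u (Suc n)) (u (Suc n)) - op_ip lam L (u n) (u n)
          \<le> dt / \<kappa> * (nrm lam (F n))\<^sup>2"
        using dt by (simp only: mult_le_cancel_left_pos)
      then show ?thesis by linarith
    qed
    then have "op_ip lam L (u N) (u N) \<le> op_ip lam L (u 0) (u 0) + (\<Sum>n<N. dt / \<kappa> * (nrm lam (F n))\<^sup>2)"
      by (rule telescope_bound[where a = "\<lambda>n. op_ip lam L (u n) (u n)"])
    then show "(op_nrm lam L (u N))\<^sup>2 \<le> (op_nrm lam L (u 0))\<^sup>2 + dt / \<kappa> * (\<Sum>n<N. (nrm lam (F n))\<^sup>2)"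
      by (simp add: op_nrm_sq sum_distrib_left)
  next
    fix n
    assume hyp: "(\<forall>t\<in>{0..T}. \<forall>\<omega>. f t \<omega> = 0) \<and> symmetric_op L \<and> (Cdet \<ge> 1 / 2 \<or>
        Cdet < 1 / 2 \<and> dt / h ^ (2 * p) \<le> 2 / (CI\<^sup>2 * CB * (1 - 2 * Cdet)))" and n: "n < N"
    \<comment> \<open>\<open>f\<close> is known to vanish only on \<open>{0..T}\<close>, so both
      evaluation times of the step must be located there; the last one is \<open>T\<close>
      itself.\<close>
    have "real N * dt = T"
      using N_pos by (simp add: dt_eq)
    then have "real k * dt \<in> {0..T}" if "k \<le> N" for k
      using mult_right_mono[of "real k" "real N" dt] that dt by simp
    then have f_0: "f (real k * dt) \<omega> = 0" if "k \<le> N" for k \<omega>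
      using hyp that by blast
    have "f (real n * dt) \<omega> = 0" "f (real (Suc n) * dt) \<omega> = 0" for \<omega>
      using n by (intro f_0; simp)+
    moreover obtain \<theta> where "\<And>\<omega>. F n \<omega> = (1 - \<theta>) *\<^sub>R f (real n * dt) \<omega> + \<theta> *\<^sub>R f (real (Suc n) * dt) \<omega>"
      using rhs n unfolding rhs_eval_def by blast
    ultimately have "F n \<omega> = 0" for \<omega>
      by (simp del: of_nat_Suc)
    then have "ip lam (F n) (\<lambda>\<omega>. \<iota> (d n \<omega>)) = 0"
      by (simp add: ip_def)
    then have "dt * (op_ip lam L (u (Suc n)) (u (Suc n)) - op_ip lam L (u n) (u n)) \<le> 0"
      using energy_L[OF n conjunct1[OF conjunct2[OF hyp]], of 0] conjunct2[OF conjunct2[OF hyp]]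
      by (simp only: diff_0_right mult_zero_left mult_zero_right zero_le_numeral simp_thms)
    then have "op_ip lam L (u (Suc n)) (u (Suc n)) \<le> op_ip lam L (u n) (u n)"
      using dt by (simp only: mult_le_0_iff) linarith
    then show "op_nrm lam L (u (Suc n)) \<le> op_nrm lam L (u n)"
      by (simp add: op_nrm_def)
  qed
qed

end
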